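(* Let $k\ge 0$ be an integer, let $p_1,\dots,p_k$ be distinct primes, and let $\Gamma_k$ be the $k$-dprime divisor function graph of $n=p_1p_2\cdots p_k$. Then the hyper-Wiener index of $\Gamma_k$ is $$WW(\Gamma_k)=2^{k-1}\bigl(2^{k+1}+2^k+1\bigr)-2\cdot 3^k.$$
   Context: For $n=p_1p_2\cdots p_k$ with $p_1,\dots,p_k$ distinct primes, the $k$-dprime divisor function graph $\Gamma_k=G_{D(n)}$ is the simple graph with vertex set $V(\Gamma_k)=\{u\in\mathbb{Z}_{>0}: u\mid n\}$ and edge set $E(\Gamma_k)=\{uv: u\neq v,\ u\mid v \text{ or } v\mid u\}$. The hyper-Wiener index is $WW(\Gamma_k)=\frac12\sum_{\{u,v\}\subseteq V(\Gamma_k)}\bigl[d_{\Gamma_k}(u,v)+d_{\Gamma_k}(u,v)^2\bigr]$, summed over unordered pairs of distinct vertices, where $d_{\Gamma_k}$ is the shortest-path distance. *)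

theory Defs
  imports
    "HOL-Computational_Algebra.Primes"
    "Graph_Theory.Pair_Digraph"
    "Graph_Theory.Shortest_Path"
begin

text \<open>
  As in the Graph_Theory library, an undirected edge \<open>uv\<close> of a simple graph is represented by the
  two arcs \<open>(u, v)\<close> and \<open>(v, u)\<close>.
\<close>

definition divisor_function_graph :: "nat \<Rightarrow> nat pair_pre_digraph" where
  "divisor_function_graph n =
     \<lparr> pverts = {u. 0 < u \<and> u dvd n},
       parcs = {(u, v). 0 < u \<and> u dvd n \<and> 0 < v \<and> v dvd n \<and> u \<noteq> v \<and> (u dvd v \<or> v dvd u)} \<rparr>"

lemma pair_graph_divisor_function_graph:
  assumes "n > 0"
  shows "pair_graph (divisor_function_graph n)"
proof -
  have V: "finite {u. 0 < u \<and> u dvd n}"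
    using assms by (auto intro: finite_subset[OF _ finite_divisors_nat[OF assms]])
  have A: "finite {(u, v). 0 < u \<and> u dvd n \<and> 0 < v \<and> v dvd n \<and> u \<noteq> v \<and> (u dvd v \<or> v dvd u)}"
    by (rule finite_subset[OF _ finite_cartesian_product[OF V V]]) auto
  show ?thesis
    by unfold_locales
      (use V A in \<open>auto simp: divisor_function_graph_def symmetric_def intro!: symI\<close>)
qed

text \<open>
  Shortest-path distance: the library's minimal walk cost \<open>\<mu>\<close> with unit weights, so that the cost
  of a walk is its number of arcs. Its value is \<open>\<infinity>\<close> if no walk exists.
\<close>

definition graph_dist :: "('a, 'b) pre_digraph \<Rightarrow> 'a \<Rightarrow> 'a \<Rightarrow> ereal" where
  "graph_dist G u v = wf_digraph.\<mu> G (\<lambda>_. 1) u v"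

lemma (in wf_digraph) graph_dist_eq_INF_length:
  "graph_dist G u v = (INF p \<in> {p. awalk u p v}. ereal (real (length p)))"
  by (simp add: graph_dist_def \<mu>_def awalk_cost_def sum_list_triv)

text \<open>
  Each unordered pair of distinct vertices is counted once, through its representative \<open>(u, v)\<close> with
  \<open>u < v\<close>; the choice is irrelevant in an undirected graph, where the distance is symmetric.
  The value is an extended real, hence \<open>\<infinity>\<close> on disconnected finite graphs.
\<close>

definition hyper_Wiener_index :: "('a :: linorder, 'b) pre_digraph \<Rightarrow> ereal" where
  "hyper_Wiener_index G =
     1 / 2 * (\<Sum>(u, v) \<in> {(u, v). u \<in> verts G \<and> v \<in> verts G \<and> u < v}.
       graph_dist G u v + (graph_dist G u v)\<^sup>2)"

end

theory Submission
  imports Defs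
begin

text \<open>
  Distinct vertices \<open>u < v\<close> are at distance 1 if \<open>u dvd v\<close> and otherwise at distance 2, through the
  vertex 1; they contribute 1 or 3 to the index. There are \<open>2 ^ k * (2 ^ k - 1) / 2\<close> pairs, and
  \<open>3 ^ k - 2 ^ k\<close> of them are comparable: each prime divides neither, only the larger, or both of
  \<open>u dvd v\<close>.
\<close>

section \<open>Distances 1 and 2 in digraphs, then in the divisor graph\<close>

lemma (in wf_digraph) graph_dist_ge_1:
  assumes "u \<noteq> v"
  shows "1 \<le> graph_dist G u v"
  unfolding graph_dist_eq_INF_length
proof (rule INF_greatest)
  fix p assume "p \<in> {p. awalk u p v}"
  with assms have "p \<noteq> []"
    by auto
  then show "1 \<le> ereal (real (length p))"
    by (cases p) auto
qed

lemma (in wf_digraph) graph_dist_le_length: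
  "awalk u p v \<Longrightarrow> graph_dist G u v \<le> ereal (real (length p))"
  unfolding graph_dist_eq_INF_length by (rule INF_lower) simp

lemma (in wf_digraph) graph_dist_adjacent:
  assumes "u \<noteq> v" "u \<rightarrow>\<^bsub>G\<^esub> v"
  shows "graph_dist G u v = 1"
proof -
  obtain e where "e \<in> arcs G" "tail G e = u" "head G e = v"
    using assms(2) by (auto simp: arcs_ends_def arc_to_ends_def)
  then have "awalk u [e] v"
    using arc_implies_awalk by blast
  from graph_dist_le_length[OF this] graph_dist_ge_1[OF assms(1)] show ?thesis
    by (simp add: one_ereal_def)
qed

text \<open>The walk through \<open>w\<close> gives the upper bound. For the lower bound, an empty
  walk would force \<open>u = v\<close> and a one-arc walk would make \<open>u\<close> and
  \<open>v\<close> adjacent.\<close>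

lemma (in wf_digraph) graph_dist_common_neighbour:
  assumes "u \<noteq> v" "\<not> u \<rightarrow>\<^bsub>G\<^esub> v" "u \<rightarrow>\<^bsub>G\<^esub> w" "w \<rightarrow>\<^bsub>G\<^esub> v"
  shows "graph_dist G u v = 2"
proof (rule antisym)
  obtain e f where "e \<in> arcs G" "tail G e = u" "head G e = w"
    "f \<in> arcs G" "tail G f = w" "head G f = v"
    using assms(3,4) by (auto simp: arcs_ends_def arc_to_ends_def)
  then have "awalk u [e, f] v"
    by (auto simp: awalk_Cons_iff awalk_Nil_iff)
  from graph_dist_le_length[OF this] show "graph_dist G u v \<le> 2"
    by simp
next
  show "2 \<le> graph_dist G u v"
    unfolding graph_dist_eq_INF_length
  proof (rule INF_greatest)
    fix p assume "p \<in> {p. awalk u p v}"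
    then have p: "awalk u p v"
      by simp
    have "p \<noteq> []"
      using p assms(1) by auto
    moreover have "p \<noteq> [e]" for e
      using p assms(2) by (auto simp: awalk_Cons_iff awalk_Nil_iff arcs_ends_def arc_to_ends_def)
    ultimately have "2 \<le> length p"
      by (metis One_nat_def Suc_1 Suc_leI length_0_conv length_Suc_conv less_one linorder_neqE_nat not_less_eq)
    then have "ereal (real 2) \<le> ereal (real (length p))"
      by (simp only: ereal_less_eq of_nat_le_iff)
    then show "2 \<le> ereal (real (length p))"
      by simp
  qed
qed

text \<open>As \<open>0 < u < v\<close>, comparability can only mean \<open>u dvd v\<close>.
  Incomparable vertices have the common neighbour 1.\<close>

lemma graph_dist_divisor_function_graph:
  assumes "n > 0" "u dvd n" "v dvd n" "u < v"
  shows "graph_dist (with_proj (divisor_function_graph n)) u v = (if u dvd v then 1 else 2)"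
proof -
  let ?G = "divisor_function_graph n"
  interpret pair_graph ?G
    by (rule pair_graph_divisor_function_graph[OF assms(1)])
  have pos: "0 < u" "0 < v"
    using assms by (auto intro: dvd_pos_nat)
  have dom: "x \<rightarrow>\<^bsub>with_proj ?G\<^esub> y \<longleftrightarrow>
      0 < x \<and> x dvd n \<and> 0 < y \<and> y dvd n \<and> x \<noteq> y \<and> (x dvd y \<or> y dvd x)" for x y
    by (simp add: arcs_ends_conv divisor_function_graph_def)
  have ndvd: "\<not> v dvd u"
    using assms(4) pos nat_dvd_not_less by blast
  show ?thesis
  proof (cases "u dvd v")
    case True
    then show ?thesis
      using assms pos dom graph_dist_adjacent[of u v] by simp
  next
    case False
    \<comment> \<open>Since 1 divides everything, neither of two incomparable vertices is 1; as the
      graph has no loops, this is what makes 1 adjacent to both.\<close>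
    then have "u \<noteq> 1" "v \<noteq> 1"
      using ndvd by auto
    then show ?thesis
      using False ndvd assms pos dom graph_dist_common_neighbour[of u v 1] by auto
  qed
qed

section \<open>Divisors of products of distinct primes\<close>

text \<open>A divisor of \<open>q * m\<close> either avoids \<open>q\<close>, hence is coprime to it
  and divides \<open>m\<close>, or is \<open>q\<close> times a divisor of \<open>m\<close>. The
  summand is left arbitrary so that both the divisor count and the sum of divisor counts obey this
  recursion.\<close>

lemma sum_divisors_prime_mult:
  fixes f :: "nat \<Rightarrow> 'a :: comm_monoid_add"
  assumes "prime q" "m > 0" "\<not> q dvd m"
  shows "(\<Sum>d | d dvd q * m. f d) = (\<Sum>d | d dvd m. f d) + (\<Sum>d | d dvd m. f (q * d))"
proof -
  have "{d. d dvd q * m} = {d. d dvd m} \<union> (*) q ` {d. d dvd m}" (is "_ = ?A \<union> ?B")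
  proof (intro set_eqI iffI)
    fix d assume "d \<in> {d. d dvd q * m}"
    then have d: "d dvd q * m"
      by simp
    show "d \<in> ?A \<union> ?B"
    proof (cases "q dvd d")
      case True
      with d assms(1) show ?thesis
        by (auto elim!: dvdE[of q d])
    next
      case False
      then have "coprime d q"
        using assms(1) prime_imp_coprime coprime_commute by blast
      with d show ?thesis
        by (simp add: coprime_dvd_mult_right_iff)
    qed
  qed auto
  moreover have "?A \<inter> ?B = {}"
    using assms(3) by (auto dest: dvd_mult_left)
  moreover have "finite ?A"
    using assms(2) by (rule finite_divisors_nat)
  moreover have "inj_on ((*) q) ?A"
    using prime_gt_0_nat[OF assms(1)] by (auto simp: inj_on_def)
  ultimately show ?thesis
    by (simp add: sum.union_disjoint sum.reindex)
qed

lemma card_divisors_prime_mult: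
  assumes "prime q" "m > 0" "\<not> q dvd m"
  shows "card {d. d dvd q * m} = 2 * card {d::nat. d dvd m}"
  using sum_divisors_prime_mult[OF assms, of "\<lambda>_. 1::nat"] by simp

lemma not_dvd_prod_primes:
  fixes p :: "'b \<Rightarrow> nat"
  assumes "finite I" "prime q" "\<And>i. i \<in> I \<Longrightarrow> prime (p i)" "q \<notin> p ` I"
  shows "\<not> q dvd (\<Prod>i\<in>I. p i)"
proof
  assume "q dvd (\<Prod>i\<in>I. p i)"
  then obtain i where "i \<in> I" "q dvd p i"
    using prime_dvd_prod_iff[OF assms(1,2)] by blast
  with assms show False
    by (metis imageI primes_dvd_imp_eq)
qed

lemma card_divisors_prod_primes:
  fixes p :: "'b \<Rightarrow> nat"
  assumes "finite I" "\<And>i. i \<in> I \<Longrightarrow> prime (p i)" "inj_on p I"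
  shows "card {d. d dvd (\<Prod>i\<in>I. p i)} = 2 ^ card I"
  using assms
proof (induction I)
  case (insert i I)
  have "\<not> p i dvd (\<Prod>i\<in>I. p i)"
    by (rule not_dvd_prod_primes) (use insert.hyps insert.prems in auto)
  moreover have "(\<Prod>i\<in>I. p i) > 0"
    by (rule prod_pos) (use insert.prems in \<open>simp add: prime_gt_0_nat\<close>)
  ultimately show ?case
    using insert by (simp add: card_divisors_prime_mult)
qed simp

text \<open>The sum counts the chains \<open>u dvd v\<close> below the product. A new prime triples
  it: the old \<open>v\<close> contribute the old sum, and their multiples by the new prime
  contribute twice that sum.\<close>

lemma sum_card_divisors_prod_primes:
  fixes p :: "'b \<Rightarrow> nat"
  assumes "finite I" "\<And>i. i \<in> I \<Longrightarrow> prime (p i)" "inj_on p I"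
  shows "(\<Sum>v | v dvd (\<Prod>i\<in>I. p i). card {u. u dvd v}) = 3 ^ card I"
  using assms
proof (induction I)
  case (insert i I)
  let ?m = "\<Prod>i\<in>I. p i"
  have q: "prime (p i)"
    using insert.prems by simp
  have q': "\<not> p i dvd ?m"
    by (rule not_dvd_prod_primes) (use insert.hyps insert.prems in auto)
  have m: "?m > 0"
    by (rule prod_pos) (use insert.prems in \<open>simp add: prime_gt_0_nat\<close>)
  \<comment> \<open>Doubling applies to each \<open>v\<close> because \<open>p i\<close> does not
    divide \<open>?m\<close> and so does not divide \<open>v\<close>.\<close>
  have "(\<Sum>v | v dvd ?m. card {u. u dvd p i * v}) = (\<Sum>v | v dvd ?m. 2 * card {u. u dvd v})"
  proof (rule sum.cong)
    fix v assume "v \<in> {v. v dvd ?m}"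
    then show "card {u. u dvd p i * v} = 2 * card {u. u dvd v}"
      using q q' m by (intro card_divisors_prime_mult) (auto intro: dvd_pos_nat dest: dvd_trans)
  qed simp
  then show ?case
    using insert q q' m by (simp add: sum_divisors_prime_mult flip: sum_distrib_left)
qed simp

section \<open>Counting ordered pairs of divisors\<close>

text \<open>The square of \<open>V\<close> splits into the diagonal, the increasing pairs and their
  mirror images. The additive form avoids subtraction and division of naturals.\<close>

lemma card_less_pairs:
  fixes V :: "'a :: linorder set"
  assumes "finite V"
  shows "card V + 2 * card {(u, v). u \<in> V \<and> v \<in> V \<and> u < v} = card V * card V"
proof -
  let ?L = "{(u, v). u \<in> V \<and> v \<in> V \<and> u < v}"
  have fin: "finite ?L"
    by (rule finite_subset[of _ "V \<times> V"]) (use assms in auto)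
  have "V \<times> V = (\<lambda>v. (v, v)) ` V \<union> (?L \<union> prod.swap ` ?L)"
    by (auto simp: image_iff)
  moreover have "card ((\<lambda>v. (v, v)) ` V \<union> (?L \<union> prod.swap ` ?L))
      = card ((\<lambda>v. (v, v)) ` V) + card (?L \<union> prod.swap ` ?L)"
    by (rule card_Un_disjoint) (use assms fin in auto)
  moreover have "card (?L \<union> prod.swap ` ?L) = card ?L + card (prod.swap ` ?L)"
    by (rule card_Un_disjoint) (use assms fin in auto)
  moreover have "card ((\<lambda>v. (v, v)) ` V) = card V" "card (prod.swap ` ?L) = card ?L"
    by (auto intro!: card_image simp: inj_on_def)
  ultimately show ?thesis
    using card_cartesian_product[of V V] by simp
qed

text \<open>Both sides count pairs with \<open>u dvd v\<close> and \<open>v dvd n\<close>: the right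
  side groups them by \<open>v\<close>, the left side separates the diagonal from the proper
  divisors.\<close>

lemma card_proper_divisor_pairs:
  fixes n :: nat
  assumes "n > 0"
  shows "card {(u, v). u dvd n \<and> v dvd n \<and> u < v \<and> u dvd v} + card {d. d dvd n}
    = (\<Sum>v | v dvd n. card {u. u dvd v})" (is "card ?P + card ?D = _")
proof -
  have fin: "finite ?D"
    using assms by (rule finite_divisors_nat)
  have finP: "finite ?P"
    by (rule finite_subset[of _ "?D \<times> ?D"]) (use fin in auto)
  have pos: "v > 0" if "v dvd n" for v
    using assms that by (rule dvd_pos_nat)
  have "(\<Sum>v\<in>?D. card {u. u dvd v}) = card (SIGMA v:?D. {u. u dvd v})"
    by (rule card_SigmaI[symmetric]) (use fin pos in auto)
  also have "(SIGMA v:?D. {u. u dvd v}) = prod.swap ` ?P \<union> (\<lambda>v. (v, v)) ` ?D"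
  proof (intro set_eqI iffI)
    fix x assume "x \<in> (SIGMA v:?D. {u. u dvd v})"
    then obtain u v where x: "x = (v, u)" "v dvd n" "u dvd v"
      by auto
    then have "u dvd n" "u \<le> v"
      using dvd_trans dvd_imp_le pos by blast+
    with x show "x \<in> prod.swap ` ?P \<union> (\<lambda>v. (v, v)) ` ?D"
      by (cases "u = v") (auto simp: image_iff)
  qed auto
  also have "card \<dots> = card (prod.swap ` ?P) + card ((\<lambda>v. (v, v)) ` ?D)"
    by (rule card_Un_disjoint) (use fin finP in auto)
  also have "card (prod.swap ` ?P) = card ?P"
    by (auto intro!: card_image simp: inj_on_def)
  also have "card ((\<lambda>v. (v, v)) ` ?D) = card ?D"
    by (auto intro!: card_image simp: inj_on_def)
  finally show ?thesis
    by simp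
qed

section \<open>Evaluation of the index\<close>

lemma hyper_Wiener_index_divisor_function_graph:
  assumes "n > 0"
  shows "hyper_Wiener_index (with_proj (divisor_function_graph n)) =
    ereal (3 * real (card {(u, v). u dvd n \<and> v dvd n \<and> u < v})
      - 2 * real (card {(u, v). u dvd n \<and> v dvd n \<and> u < v \<and> u dvd v}))"
    (is "_ = ereal (3 * real (card ?L) - 2 * real (card ?P))")
proof -
  let ?G = "with_proj (divisor_function_graph n)"
  have fin: "finite ?L"
    by (rule finite_subset[of _ "{d. d dvd n} \<times> {d. d dvd n}"])
      (use finite_divisors_nat[OF assms] in auto)
  have L: "{(u, v). u \<in> verts ?G \<and> v \<in> verts ?G \<and> u < v} = ?L"
    using assms by (auto simp: divisor_function_graph_def intro: dvd_pos_nat)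
  \<comment> \<open>Distance 2 gives 2 + 4 = 6 and distance 1 gives 1 + 1 = 6 - 4; the final factor
    1/2 turns 6 and 4 into 3 and 2.\<close>
  have "(\<Sum>(u, v)\<in>?L. graph_dist ?G u v + (graph_dist ?G u v)\<^sup>2)
      = (\<Sum>x\<in>?L. ereal (6 - 4 * (if fst x dvd snd x then 1 else 0)))"
    by (rule sum.cong)
      (auto simp: graph_dist_divisor_function_graph[OF assms] power2_eq_square one_ereal_def)
  also have "\<dots> = ereal (6 * real (card ?L) - 4 * (\<Sum>x\<in>?L. if fst x dvd snd x then 1 else 0))"
    by (simp add: sum_subtractf sum_distrib_left)
  also have "(\<Sum>x\<in>?L. if fst x dvd snd x then 1 else 0) = real (card (?L \<inter> {x. fst x dvd snd x}))"
    using fin by (simp add: sum.If_cases)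
  also have "?L \<inter> {x. fst x dvd snd x} = ?P"
    by auto
  finally show ?thesis
    unfolding hyper_Wiener_index_def L by (simp add: one_ereal_def)
qed

theorem theorem3p4:
  fixes k :: nat and p :: "nat \<Rightarrow> nat"
  assumes "\<And>i. i \<in> {1..k} \<Longrightarrow> prime (p i)"
    and "inj_on p {1..k}"
  shows "hyper_Wiener_index (with_proj (divisor_function_graph (\<Prod>i = 1..k. p i)))
    = ereal (2 powi (int k - 1) * (2 ^ (k + 1) + 2 ^ k + 1) - 2 * 3 ^ k)"
proof -
  define n where "n = (\<Prod>i = 1..k. p i)"
  have n: "n > 0"
    unfolding n_def by (rule prod_pos) (use assms(1) prime_gt_0_nat in blast)
  let ?L = "{(u, v). u dvd n \<and> v dvd n \<and> u < v}"
  let ?P = "{(u, v). u dvd n \<and> v dvd n \<and> u < v \<and> u dvd v}"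
  have D: "card {d. d dvd n} = 2 ^ k"
    using card_divisors_prod_primes[OF _ assms] by (simp add: n_def)
  have "2 ^ k + 2 * card ?L = 2 ^ k * 2 ^ k"
    using card_less_pairs[OF finite_divisors_nat[OF n]] D by simp
  \<comment> \<open>Passing to the reals makes the subtraction and the halving that follow
    exact.\<close>
  then have "real (2 ^ k + 2 * card ?L) = real (2 ^ k * 2 ^ k)"
    by (rule arg_cong)
  then have L: "real (card ?L) = (2 ^ k * 2 ^ k - 2 ^ k) / 2"
    by simp
  have "card ?P + 2 ^ k = 3 ^ k"
    using card_proper_divisor_pairs[OF n] sum_card_divisors_prod_primes[OF _ assms] D
    by (simp add: n_def)
  then have "real (card ?P + 2 ^ k) = real (3 ^ k)"
    by (rule arg_cong)
  then have P: "real (card ?P) = 3 ^ k - 2 ^ k"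
    by simp
  \<comment> \<open>The exponent is an integer because it equals -1 for
    \<open>k = 0\<close>.\<close>
  have "2 powi (int k - 1) = (2 ^ k / 2 :: real)"
    by (simp add: power_int_diff)
  \<comment> \<open>With \<open>x = 2 ^ k\<close>, the identity is
    \<open>3 * (x * x - x) / 2 + 2 * x = x / 2 * (3 * x + 1)\<close>, where \<open>3 * x\<close> is
    \<open>2 ^ (k + 1) + 2 ^ k\<close>.\<close>
  then show ?thesis
    unfolding n_def[symmetric] hyper_Wiener_index_divisor_function_graph[OF n] L P
    by (simp add: field_simps)
qed

end
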